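(* Every pairwise semi-$T_\omega$ bispace $(X,\kappa_1,\kappa_2)$ is pairwise semi-$T_0$.
   Context: A $\sigma$-space $(X,\kappa)$ is a nonempty set $X$ with a family $\kappa$ of subsets of $X$ (the $\kappa$-open sets) such that $\emptyset,X\in\kappa$, and $\kappa$ is closed under countable unions and finite intersections; complements of $\kappa$-open sets are $\kappa$-closed. A bispace $(X,\kappa_1,\kappa_2)$ is a nonempty set $X$ with two families $\kappa_1,\kappa_2$ such that $(X,\kappa_1)$ and $(X,\kappa_2)$ are $\sigma$-spaces. For $i\in\{1,2\}$, the $\kappa_i$-closure $\overline{G_{\kappa_i}}$ of $G\subseteq X$ is the intersection of all $\kappa_i$-closed sets containing $G$ (it need not be $\kappa_i$-closed). A set $B\subseteq X$ is $s\kappa_i$-open (semi $\kappa_i$-open) if there is a $\kappa_i$-open set $G$ with $G\subseteq B\subseteq\overline{G_{\kappa_i}}$; $B$ is $s\kappa_i$-closed if $X\setminus B$ is $s\kappa_i$-open. For $i,j\in\{1,2\}$, $i\neq j$, a set $B\subseteq X$ is $(j\text{-}i)sg_\kappa^*$-closed if there is an $s\kappa_i$-closed set $F\supseteq B$ such that $F\subseteq O$ for every $s\kappa_j$-open set $O$ with $B\subseteq O$. Pairwise semi-$T_\omega$: for all $i,j\in\{1,2\}$ with $i\neq j$, every $(j\text{-}i)sg_\kappa^*$-closed set is $s\kappa_i$-closed. Pairwise semi-$T_0$: for all $x,y\in X$ with $x\neq y$, either there is an $s\kappa_1$-open set $U$ with $x\in U$, $y\notin U$, or there is an $s\kappa_2$-open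 set $V$ with $y\in V$, $x\notin V$. *)

theory Defs
  imports Main "HOL-Library.Countable_Set"
begin

definition sigma_space :: "'a set \<Rightarrow> 'a set set \<Rightarrow> bool" where
  "sigma_space X \<kappa> \<longleftrightarrow>
     X \<noteq> {} \<and> \<kappa> \<subseteq> Pow X \<and> {} \<in> \<kappa> \<and> X \<in> \<kappa> \<and>
     (\<forall>\<U>. countable \<U> \<and> \<U> \<subseteq> \<kappa> \<longrightarrow> \<Union>\<U> \<in> \<kappa>) \<and>
     (\<forall>\<U>. finite \<U> \<and> \<U> \<noteq> {} \<and> \<U> \<subseteq> \<kappa> \<longrightarrow> \<Inter>\<U> \<in> \<kappa>)"

definition bispace :: "'a set \<Rightarrow> 'a set set \<Rightarrow> 'a set set \<Rightarrow> bool" where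
  "bispace X \<kappa>\<^sub>1 \<kappa>\<^sub>2 \<longleftrightarrow> sigma_space X \<kappa>\<^sub>1 \<and> sigma_space X \<kappa>\<^sub>2"

definition kclosed :: "'a set \<Rightarrow> 'a set set \<Rightarrow> 'a set \<Rightarrow> bool" where
  "kclosed X \<kappa> F \<longleftrightarrow> F \<subseteq> X \<and> X - F \<in> \<kappa>"

(* In a sigma-space this set need not itself be closed. *)
definition kclosure :: "'a set \<Rightarrow> 'a set set \<Rightarrow> 'a set \<Rightarrow> 'a set" where
  "kclosure X \<kappa> G = \<Inter>{F. kclosed X \<kappa> F \<and> G \<subseteq> F}"

definition semi_open :: "'a set \<Rightarrow> 'a set set \<Rightarrow> 'a set \<Rightarrow> bool" where
  "semi_open X \<kappa> B \<longleftrightarrow> B \<subseteq> X \<and> (\<exists>G\<in>\<kappa>. G \<subseteq> B \<and> B \<subseteq> kclosure X \<kappa> G)"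

definition semi_closed :: "'a set \<Rightarrow> 'a set set \<Rightarrow> 'a set \<Rightarrow> bool" where
  "semi_closed X \<kappa> B \<longleftrightarrow> B \<subseteq> X \<and> semi_open X \<kappa> (X - B)"

(* The (j-i) version takes the families in the order kappa_j, kappa_i:
   the closed superset F refers to kappa_i, the open supersets to kappa_j. *)
definition sg_star_closed :: "'a set \<Rightarrow> 'a set set \<Rightarrow> 'a set set \<Rightarrow> 'a set \<Rightarrow> bool" where
  "sg_star_closed X \<kappa>\<^sub>j \<kappa>\<^sub>i B \<longleftrightarrow>
     B \<subseteq> X \<and>
     (\<exists>F. semi_closed X \<kappa>\<^sub>i F \<and> B \<subseteq> F \<and>
          (\<forall>O'. semi_open X \<kappa>\<^sub>j O' \<and> B \<subseteq> O' \<longrightarrow> F \<subseteq> O'))"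

(* The two conjuncts are the cases (i, j) = (1, 2) and (i, j) = (2, 1). *)
definition pairwise_semi_T_omega :: "'a set \<Rightarrow> 'a set set \<Rightarrow> 'a set set \<Rightarrow> bool" where
  "pairwise_semi_T_omega X \<kappa>\<^sub>1 \<kappa>\<^sub>2 \<longleftrightarrow>
     (\<forall>B. sg_star_closed X \<kappa>\<^sub>2 \<kappa>\<^sub>1 B \<longrightarrow> semi_closed X \<kappa>\<^sub>1 B) \<and>
     (\<forall>B. sg_star_closed X \<kappa>\<^sub>1 \<kappa>\<^sub>2 B \<longrightarrow> semi_closed X \<kappa>\<^sub>2 B)"

definition pairwise_semi_T0 :: "'a set \<Rightarrow> 'a set set \<Rightarrow> 'a set set \<Rightarrow> bool" where
  "pairwise_semi_T0 X \<kappa>\<^sub>1 \<kappa>\<^sub>2 \<longleftrightarrow>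
     (\<forall>x\<in>X. \<forall>y\<in>X. x \<noteq> y \<longrightarrow>
        (\<exists>U. semi_open X \<kappa>\<^sub>1 U \<and> x \<in> U \<and> y \<notin> U) \<or>
        (\<exists>V. semi_open X \<kappa>\<^sub>2 V \<and> y \<in> V \<and> x \<notin> V))"

end

theory Submission
  imports Defs
begin

text \<open>
  Any two distinct points \<open>x\<close> and \<open>y\<close> are separated by one of the two sets
  \<open>{x}\<close> and \<open>X - {x}\<close>. The only subsets of \<open>X\<close> that contain \<open>X - {x}\<close> are \<open>X - {x}\<close> and \<open>X\<close>.
  If \<open>X - {x}\<close> is semi \<open>\<kappa>\<^sub>2\<close>-open, it contains \<open>y\<close> and misses \<open>x\<close>.
  Otherwise \<open>X\<close> is its only semi \<open>\<kappa>\<^sub>2\<close>-open superset, so the semi \<open>\<kappa>\<^sub>1\<close>-closed set \<open>X\<close>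
  witnesses that \<open>X - {x}\<close> is generalized closed; by semi-\<open>T\<^sub>\<omega>\<close> it is then semi
  \<open>\<kappa>\<^sub>1\<close>-closed, that is, \<open>{x}\<close> is semi \<open>\<kappa>\<^sub>1\<close>-open.
\<close>

lemma semi_closed_space:
  assumes "{} \<in> \<kappa>"
  shows "semi_closed X \<kappa> X"
  using assms by (auto simp: semi_closed_def semi_open_def)

text \<open>
  This is the analogue of the dichotomy in a \<open>T\<^sub>1\<^sub>/\<^sub>2\<close> space, where every singleton is open or closed.
  The two alternatives refer to different families, which is what makes it fit the
  asymmetric pairwise \<open>T\<^sub>0\<close> condition.
\<close>
lemma singleton_semi_open_or_complement_semi_open:
  assumes empty: "{} \<in> \<kappa>\<^sub>i"
    and T_omega: "\<And>B. sg_star_closed X \<kappa>\<^sub>j \<kappa>\<^sub>i B \<Longrightarrow> semi_closed X \<kappa>\<^sub>i B"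
    and x: "x \<in> X"
  shows "semi_open X \<kappa>\<^sub>i {x} \<or> semi_open X \<kappa>\<^sub>j (X - {x})"
proof (rule disjCI)
  assume not_open: "\<not> semi_open X \<kappa>\<^sub>j (X - {x})"
  have "X \<subseteq> S" if S: "semi_open X \<kappa>\<^sub>j S" "X - {x} \<subseteq> S" for S
  proof -
    have "S \<subseteq> X"
      using S by (simp add: semi_open_def)
    moreover have "S \<noteq> X - {x}"
      using S not_open by auto
    ultimately show ?thesis
      using S by blast
  qed
  then have "sg_star_closed X \<kappa>\<^sub>j \<kappa>\<^sub>i (X - {x})"
    unfolding sg_star_closed_def using semi_closed_space[OF empty] by blast
  then have "semi_open X \<kappa>\<^sub>i (X - (X - {x}))"
    using T_omega by (simp add: semi_closed_def)
  moreover have "X - (X - {x}) = {x}"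
    using x by blast
  ultimately show "semi_open X \<kappa>\<^sub>i {x}"
    by simp
qed

theorem theorem4p5:
  fixes X :: "'a set" and \<kappa>\<^sub>1 \<kappa>\<^sub>2 :: "'a set set"
  assumes "bispace X \<kappa>\<^sub>1 \<kappa>\<^sub>2"
    and "pairwise_semi_T_omega X \<kappa>\<^sub>1 \<kappa>\<^sub>2"
  shows "pairwise_semi_T0 X \<kappa>\<^sub>1 \<kappa>\<^sub>2"
  unfolding pairwise_semi_T0_def
proof (intro ballI impI)
  fix x y
  assume xy: "x \<in> X" "y \<in> X" "x \<noteq> y"
  have "{} \<in> \<kappa>\<^sub>1"
    using assms(1) by (simp add: bispace_def sigma_space_def)
  then have "semi_open X \<kappa>\<^sub>1 {x} \<or> semi_open X \<kappa>\<^sub>2 (X - {x})"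
    using assms(2) xy(1)
    by (intro singleton_semi_open_or_complement_semi_open)
      (auto simp: pairwise_semi_T_omega_def)
  then show "(\<exists>U. semi_open X \<kappa>\<^sub>1 U \<and> x \<in> U \<and> y \<notin> U) \<or>
      (\<exists>V. semi_open X \<kappa>\<^sub>2 V \<and> y \<in> V \<and> x \<notin> V)"
    using xy by blast
qed

end
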